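(* Assume the following principle (DW): for every tall Borel ideal $\mathcal I$ on $\omega$ whose quotient $\mathbb Q_{\mathcal I}$ adds a real, there are a $\mathbb Q_{\mathcal I}$-name for a new real and a set $X\in\mathcal I^+$ such that the name has countable width below $X$. Then there is no tall Borel ideal on $\omega$ with the Ramsey property.
   Context: All ideals on $\omega$ are proper and contain all finite sets; they are viewed as subsets of $2^\omega\cong\mathcal P(\omega)$, so "Borel" makes sense. $\mathcal I^+=\mathcal P(\omega)\setminus\mathcal I$. An ideal is tall if every infinite subset of $\omega$ has an infinite subset in the ideal. $\mathcal I$ has the Ramsey property if for every $X\in\mathcal I^+$ and every $c:[X]^2\to2$ there is $Y\subseteq X$, $Y\in\mathcal I^+$, with $c\upharpoonright[Y]^2$ constant. $\mathbb Q_{\mathcal I}=\mathcal P(\omega)/\mathcal I$ is the quotient forcing: conditions are the $\mathcal I$-positive sets, $A\le B\iff A\setminus B\in\mathcal I$, and $A\perp B\iff A\cap B\in\mathcal I$. A name for a new real is a $\mathbb Q_{\mathcal I}$-name $\dot r$ for an element of $2^\omega$ which is forced (by every condition) not to belong to the ground model; $\mathbb Q_{\mathcal I}$ adds a real if such a name exists. A name $\dot r$ for a new real has countable width below $X$ if there are maximal antichains $(\mathcal A_n)_{n\in\omega}$ of $\mathbb Q_{\mathcal I}$, with $\mathcal A_{n+1}$ refining $\mathcal A_n$ and each $A\in\mathcal A_n$ deciding $\dot r\upharpoonright n$, such that $\{A\in\mathcal A_n:A\cap X\in\mathcal I^+\}$ is countable for every $n$. *)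

theory Defs
  imports "HOL-Analysis.Analysis" "HOL-Library.Ramsey"
begin

definition ideal_on_omega :: "nat set set \<Rightarrow> bool" where
  "ideal_on_omega I \<longleftrightarrow>
     (\<forall>A. finite A \<longrightarrow> A \<in> I) \<and>
     UNIV \<notin> I \<and>
     (\<forall>A B. B \<in> I \<longrightarrow> A \<subseteq> B \<longrightarrow> A \<in> I) \<and>
     (\<forall>A B. A \<in> I \<longrightarrow> B \<in> I \<longrightarrow> A \<union> B \<in> I)"

(* Subsets of nat are identified with their characteristic functions; nat => bool carries
   the product topology of the discrete two-point space, i.e. it is Cantor space. *)
definition borel_ideal :: "nat set set \<Rightarrow> bool" where
  "borel_ideal I \<longleftrightarrow> ideal_on_omega I \<and> (\<lambda>A (n::nat). n \<in> A) ` I \<in> sets borel"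

definition positive_sets :: "nat set set \<Rightarrow> nat set set" where
  "positive_sets I = UNIV - I"

definition tall :: "nat set set \<Rightarrow> bool" where
  "tall I \<longleftrightarrow> (\<forall>A. infinite A \<longrightarrow> (\<exists>B\<subseteq>A. infinite B \<and> B \<in> I))"

definition ramsey_property :: "nat set set \<Rightarrow> bool" where
  "ramsey_property I \<longleftrightarrow>
     (\<forall>X\<in>positive_sets I. \<forall>c :: nat set \<Rightarrow> bool.
        \<exists>Y\<subseteq>X. Y \<in> positive_sets I \<and> c constant_on nsets Y 2)"

(* The forcing Q_I: the conditions are the members of positive_sets I, preordered by extends. *)

definition extends :: "nat set set \<Rightarrow> nat set \<Rightarrow> nat set \<Rightarrow> bool" where
  "extends I A B \<longleftrightarrow> A - B \<in> I"

definition incompatible :: "nat set set \<Rightarrow> nat set \<Rightarrow> nat set \<Rightarrow> bool" where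
  "incompatible I A B \<longleftrightarrow> A \<inter> B \<in> I"

definition maximal_antichain :: "nat set set \<Rightarrow> nat set set \<Rightarrow> bool" where
  "maximal_antichain I \<A> \<longleftrightarrow>
     \<A> \<subseteq> positive_sets I \<and>
     (\<forall>A\<in>\<A>. \<forall>B\<in>\<A>. A \<noteq> B \<longrightarrow> incompatible I A B) \<and>
     (\<forall>P\<in>positive_sets I. \<exists>A\<in>\<A>. \<not> incompatible I P A)"

definition refines :: "nat set set \<Rightarrow> nat set set \<Rightarrow> nat set set \<Rightarrow> bool" where
  "refines I \<A> \<B> \<longleftrightarrow> (\<forall>A\<in>\<A>. \<exists>B\<in>\<B>. extends I A B)"

(* Every name for an element of 2^omega is equivalent to a set r of pairs (check n, S) with S a
   condition; its value under a generic filter G is the characteristic function of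
   {n. \<exists>S\<in>G. (n, S) \<in> r}. *)
type_synonym real_name = "(nat \<times> nat set) set"

definition is_real_name :: "nat set set \<Rightarrow> real_name \<Rightarrow> bool" where
  "is_real_name I r \<longleftrightarrow> r \<subseteq> UNIV \<times> positive_sets I"

(* The forcing relation, given by its usual recursive clauses. A statement of the forcing
   language is represented by the predicate "P forces it"; conjunctions, and universal
   quantifiers ranging over ground-model objects, are then interpreted pointwise. The ground
   model is the ambient universe, so its reals are the x :: nat \<Rightarrow> bool. *)

definition forces_not :: "nat set set \<Rightarrow> (nat set \<Rightarrow> bool) \<Rightarrow> nat set \<Rightarrow> bool" where
  "forces_not I \<phi> P \<longleftrightarrow> (\<forall>Q\<in>positive_sets I. extends I Q P \<longrightarrow> \<not> \<phi> Q)"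

(* r(n) = 1: the conditions below some S with (n, S) \<in> r are dense below P *)
definition forces_one :: "nat set set \<Rightarrow> real_name \<Rightarrow> nat \<Rightarrow> nat set \<Rightarrow> bool" where
  "forces_one I r n P \<longleftrightarrow>
     (\<forall>Q\<in>positive_sets I. extends I Q P \<longrightarrow>
        (\<exists>R\<in>positive_sets I. extends I R Q \<and> (\<exists>S. (n, S) \<in> r \<and> extends I R S)))"

definition forces_value :: "nat set set \<Rightarrow> real_name \<Rightarrow> nat \<Rightarrow> bool \<Rightarrow> nat set \<Rightarrow> bool" where
  "forces_value I r n b P \<longleftrightarrow> (if b then forces_one I r n P else forces_not I (forces_one I r n) P)"

definition forces_eq :: "nat set set \<Rightarrow> real_name \<Rightarrow> (nat \<Rightarrow> bool) \<Rightarrow> nat set \<Rightarrow> bool" where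
  "forces_eq I r x P \<longleftrightarrow> (\<forall>n. forces_value I r n (x n) P)"

definition forces_not_ground :: "nat set set \<Rightarrow> real_name \<Rightarrow> nat set \<Rightarrow> bool" where
  "forces_not_ground I r P \<longleftrightarrow> (\<forall>x. forces_not I (forces_eq I r x) P)"

definition decides_restriction :: "nat set set \<Rightarrow> real_name \<Rightarrow> nat \<Rightarrow> nat set \<Rightarrow> bool" where
  "decides_restriction I r n P \<longleftrightarrow>
     (\<exists>s :: nat \<Rightarrow> bool. \<forall>k<n. forces_value I r k (s k) P)"

definition new_real_name :: "nat set set \<Rightarrow> real_name \<Rightarrow> bool" where
  "new_real_name I r \<longleftrightarrow> is_real_name I r \<and> (\<forall>P\<in>positive_sets I. forces_not_ground I r P)"

definition adds_real :: "nat set set \<Rightarrow> bool" where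
  "adds_real I \<longleftrightarrow> (\<exists>r. new_real_name I r)"

definition countable_width_below :: "nat set set \<Rightarrow> real_name \<Rightarrow> nat set \<Rightarrow> bool" where
  "countable_width_below I r X \<longleftrightarrow>
     (\<exists>\<A> :: nat \<Rightarrow> nat set set.
        (\<forall>n. maximal_antichain I (\<A> n)) \<and>
        (\<forall>n. refines I (\<A> (Suc n)) (\<A> n)) \<and>
        (\<forall>n. \<forall>A\<in>\<A> n. decides_restriction I r n A) \<and>
        (\<forall>n. countable {A \<in> \<A> n. A \<inter> X \<in> positive_sets I}))"

end

theory Submission
  imports Defs
begin

text \<open>Suppose \<open>I\<close> is a tall Borel ideal with the Ramsey property.

If a name for a new real had countable width below \<open>X\<close>, then every point of \<open>X\<close> would get a
branch in \<open>\<omega>\<^sup>\<omega>\<close>, namely the indices of the members of the antichains that contain it. Colouring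
pairs according to whether the lexicographic order of their branches agrees with the order of
\<open>\<omega>\<close> yields a positive \<open>Y \<subseteq> X\<close> along which the branches are monotone, hence converge; so \<open>Y\<close> lies
modulo \<open>I\<close> below one member of each antichain and decides the whole name, a contradiction.
By (DW), no restriction of \<open>I\<close> to a positive set adds a real.

Antichains consist of reals, so a quotient that adds no real is \<open>\<omega>\<close>-distributive, and
together with the Ramsey property this makes the positive sets a semiselective coideal. As in
Mathias' and Farah's local version of the Galvin--Prikry theorem, every Borel set is Ramsey with
respect to it. Applied to \<open>I\<close> itself this gives a positive set whose infinite subsets are either
all in \<open>I\<close> or all outside \<open>I\<close>; the former contradicts positivity, the latter tallness.\<close>

section \<open>Ideals and the Ramsey property\<close>

lemma ideal_finite: "ideal_on_omega I \<Longrightarrow> finite A \<Longrightarrow> A \<in> I"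
  unfolding ideal_on_omega_def by blast

lemma ideal_subset: "ideal_on_omega I \<Longrightarrow> B \<in> I \<Longrightarrow> A \<subseteq> B \<Longrightarrow> A \<in> I"
  unfolding ideal_on_omega_def by blast

lemma ideal_Un: "ideal_on_omega I \<Longrightarrow> A \<in> I \<Longrightarrow> B \<in> I \<Longrightarrow> A \<union> B \<in> I"
  unfolding ideal_on_omega_def by blast

lemma ideal_positive_infinite: "ideal_on_omega I \<Longrightarrow> A \<notin> I \<Longrightarrow> infinite A"
  using ideal_finite by blast

lemma positive_Diff:
  assumes "ideal_on_omega I" "A \<notin> I" "B \<in> I"
  shows "A - B \<notin> I"
  using ideal_Un[OF assms(1) _ assms(3), of "A - B"] ideal_subset[OF assms(1), of _ A] assms(2)
  by blast

lemma positive_Int_greaterThan: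
  assumes "ideal_on_omega I" "A \<notin> I"
  shows "A \<inter> {n<..} \<notin> I"
proof -
  have "A \<inter> {n<..} = A - {..n}" by auto
  then show ?thesis using positive_Diff[OF assms ideal_finite[OF assms(1)], of "{..n}"] by simp
qed

lemma positive_sets_iff [simp]: "A \<in> positive_sets I \<longleftrightarrow> A \<notin> I"
  by (simp add: positive_sets_def)

lemma extends_trans:
  assumes "ideal_on_omega I" "extends I A B" "extends I B C"
  shows "extends I A C"
  using ideal_subset[OF assms(1) ideal_Un[OF assms(1)], of "A - B" "B - C" "A - C"] assms(2,3)
  unfolding extends_def by blast

lemma subset_extends: "ideal_on_omega I \<Longrightarrow> A \<subseteq> B \<Longrightarrow> extends I A B"
  unfolding extends_def by (metis Diff_eq_empty_iff finite.emptyI ideal_finite)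

lemma maximal_antichain_meets:
  "maximal_antichain I \<A> \<Longrightarrow> P \<notin> I \<Longrightarrow> \<exists>A\<in>\<A>. P \<inter> A \<notin> I"
  unfolding maximal_antichain_def incompatible_def positive_sets_def by blast

lemma ramsey_property_pairs:
  fixes P :: "nat \<Rightarrow> nat \<Rightarrow> bool"
  assumes "ramsey_property I" "X \<notin> I"
  obtains Y where "Y \<subseteq> X" "Y \<notin> I" "\<And>x y. x \<in> Y \<Longrightarrow> y \<in> Y \<Longrightarrow> x < y \<Longrightarrow> P x y"
  | Y where "Y \<subseteq> X" "Y \<notin> I" "\<And>x y. x \<in> Y \<Longrightarrow> y \<in> Y \<Longrightarrow> x < y \<Longrightarrow> \<not> P x y"
proof -
  let ?c = "\<lambda>S. P (Min S) (Max S)"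
  obtain Y where Y: "Y \<subseteq> X" "Y \<notin> I" "?c constant_on nsets Y 2"
    using assms unfolding ramsey_property_def positive_sets_def by blast
  then obtain v where v: "\<And>S. S \<in> nsets Y 2 \<Longrightarrow> ?c S = v"
    unfolding constant_on_def by blast
  have "P x y = v" if "x \<in> Y" "y \<in> Y" "x < y" for x y
    using v[of "{x, y}"] that by (auto simp: nsets_def)
  then show thesis using that Y by (cases v) blast+
qed

section \<open>Names of countable width\<close>

definition lex_less :: "(nat \<Rightarrow> nat) \<Rightarrow> (nat \<Rightarrow> nat) \<Rightarrow> bool" where
  "lex_less f g \<longleftrightarrow> (\<exists>n. (\<forall>i<n. f i = g i) \<and> f n < g n)"

lemma lex_less_imp_le:
  assumes "lex_less f g" "\<And>i. i < n \<Longrightarrow> f i = g i"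
  shows "f n \<le> g n"
  using assms unfolding lex_less_def by (metis less_le_not_le linorder_neqE_nat nat_le_linear)

lemma not_lex_less_imp_le:
  assumes "\<not> lex_less f g" "\<And>i. i < n \<Longrightarrow> f i = g i"
  shows "g n \<le> f n"
  using assms unfolding lex_less_def by (meson not_le)

definition ev_const :: "nat set \<Rightarrow> (nat \<Rightarrow> nat) \<Rightarrow> bool" where
  "ev_const Y h \<longleftrightarrow> (\<exists>N v. \<forall>x\<in>Y. N \<le> x \<longrightarrow> h x = v)"

text \<open>The least value taken beyond \<open>N\<close> is attained at some \<open>x0\<close>;
  from there on \<open>h\<close> can neither rise nor fall.\<close>

lemma ev_const_antimono:
  assumes "\<And>x y. x \<in> Y \<Longrightarrow> y \<in> Y \<Longrightarrow> N \<le> x \<Longrightarrow> x < y \<Longrightarrow> h y \<le> h x"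
  shows "ev_const Y h"
proof (cases "\<exists>x\<in>Y. N \<le> x")
  case True
  then obtain x0 where x0: "x0 \<in> Y" "N \<le> x0" "\<And>x. x \<in> Y \<Longrightarrow> N \<le> x \<Longrightarrow> h x0 \<le> h x"
    using exists_least_iff[of "\<lambda>v. \<exists>x\<in>Y. N \<le> x \<and> h x = v"] by (metis not_le)
  have "h x = h x0" if "x \<in> Y" "x0 \<le> x" for x
    using assms[of x0 x] x0 that by (metis le_antisym le_trans nat_less_le)
  then show ?thesis unfolding ev_const_def by blast
next
  case False
  then show ?thesis unfolding ev_const_def by blast
qed

text \<open>Reflection to \<open>b - h x\<close> reduces this to the antitone case; the bound makes
  truncated subtraction invertible.\<close>

lemma ev_const_mono_bounded:
  assumes "\<And>x y. x \<in> Y \<Longrightarrow> y \<in> Y \<Longrightarrow> N \<le> x \<Longrightarrow> x < y \<Longrightarrow> h x \<le> h y"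
    and "\<And>x. x \<in> Y \<Longrightarrow> N \<le> x \<Longrightarrow> h x \<le> b"
  shows "ev_const Y h"
proof -
  have "ev_const Y (\<lambda>x. b - h x)"
    by (rule ev_const_antimono[where N = N]) (simp add: assms(1) diff_le_mono2)
  then obtain M v where "\<And>x. x \<in> Y \<Longrightarrow> M \<le> x \<Longrightarrow> b - h x = v"
    unfolding ev_const_def by blast
  then have "h x = b - v" if "x \<in> Y" "max M N \<le> x" for x
    using assms(2)[of x] that by fastforce
  then show ?thesis unfolding ev_const_def by blast
qed

lemma ev_const_uniform:
  fixes f :: "nat \<Rightarrow> nat \<Rightarrow> nat"
  assumes "\<And>i. i < n \<Longrightarrow> ev_const Y (\<lambda>x. f x i)"
  obtains N where "\<forall>x\<in>Y. \<forall>y\<in>Y. N \<le> x \<longrightarrow> N \<le> y \<longrightarrow> (\<forall>i<n. f x i = f y i)"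
proof -
  obtain M v where M: "\<And>i x. i < n \<Longrightarrow> x \<in> Y \<Longrightarrow> M i \<le> x \<Longrightarrow> f x i = v i"
    using assms unfolding ev_const_def by metis
  have "M i \<le> Max (M ` {..<n})" if "i < n" for i using that by auto
  then have "f x i = v i" if "i < n" "x \<in> Y" "Max (M ` {..<n}) \<le> x" for i x
    using M that by (meson order_trans)
  then show thesis using that[of "Max (M ` {..<n})"] by simp
qed

text \<open>Monotone branches converge one coordinate at a time: once the coordinates below
  \<open>n\<close> are constant, lexicographic monotonicity becomes monotonicity at
  \<open>n\<close>. Falling values stabilise by well-foundedness, rising ones because some
  \<open>E n k\<close> recurs cofinally in \<open>Y\<close>.\<close>

lemma ramsey_countable_antichains:
  fixes E :: "nat \<Rightarrow> nat \<Rightarrow> nat set"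
  assumes I: "ideal_on_omega I" and "ramsey_property I" "X \<notin> I"
    and predense: "\<And>n Y. Y \<subseteq> X \<Longrightarrow> Y \<notin> I \<Longrightarrow> \<exists>k. Y \<inter> E n k \<notin> I"
  shows "\<exists>Y\<subseteq>X. Y \<notin> I \<and> (\<forall>n. \<exists>k. Y - E n k \<in> I)"
proof -
  \<comment> \<open>The index is shifted by one; the value \<open>0\<close> marks the points outside all \<open>E n k\<close>.\<close>
  define f where "f x n = (if \<exists>k. x \<in> E n k then Suc (LEAST k. x \<in> E n k) else 0)" for x n
  have f_le: "0 < f x n \<and> f x n \<le> Suc k" if "x \<in> E n k" for x n k
    using that by (auto simp: f_def intro: Least_le)
  have f_Suc: "x \<in> E n k" if "f x n = Suc k" for x n k
    using that unfolding f_def by (metis LeastI nat.distinct(1) old.nat.inject)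
  obtain Y where Y: "Y \<subseteq> X" "Y \<notin> I" and mono:
    "(\<forall>x\<in>Y. \<forall>y\<in>Y. x < y \<longrightarrow> lex_less (f y) (f x)) \<or>
     (\<forall>x\<in>Y. \<forall>y\<in>Y. x < y \<longrightarrow> \<not> lex_less (f y) (f x))"
    by (rule ramsey_property_pairs[OF assms(2,3), of "\<lambda>x y. lex_less (f y) (f x)"]) blast+
  have hit: "\<exists>k. infinite (Y \<inter> E n k)" for n
    using predense[OF Y] ideal_finite[OF I] by blast
  have ev: "ev_const Y (\<lambda>x. f x n)" for n
  proof (induction n rule: less_induct)
    case (less n)
    obtain N where N: "\<forall>x\<in>Y. \<forall>y\<in>Y. N \<le> x \<longrightarrow> N \<le> y \<longrightarrow> (\<forall>i<n. f x i = f y i)"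
      using ev_const_uniform[of n Y f, OF less] by blast
    from mono show ?case
    proof
      assume dec: "\<forall>x\<in>Y. \<forall>y\<in>Y. x < y \<longrightarrow> lex_less (f y) (f x)"
      show ?thesis
      proof (rule ev_const_antimono)
        fix x y assume xy: "x \<in> Y" "y \<in> Y" "N \<le> x" "x < y"
        then have "\<forall>i<n. f y i = f x i" using N by (meson less_imp_le order_trans)
        then show "f y n \<le> f x n" using dec xy by (blast intro: lex_less_imp_le)
      qed
    next
      assume inc: "\<forall>x\<in>Y. \<forall>y\<in>Y. x < y \<longrightarrow> \<not> lex_less (f y) (f x)"
      have le: "f x n \<le> f y n" if "x \<in> Y" "y \<in> Y" "N \<le> x" "x < y" for x y
      proof -
        have "\<forall>i<n. f y i = f x i" using N that by (meson less_imp_le order_trans)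
        then show ?thesis using inc that by (blast intro: not_lex_less_imp_le)
      qed
      obtain k where k: "infinite (Y \<inter> E n k)" using hit by blast
      have "f x n \<le> Suc k" if x: "x \<in> Y" "N \<le> x" for x
      proof -
        \<comment> \<open>A later point of \<open>E n k\<close> caps the coordinate of every earlier
          point, its own least index being at most \<open>k\<close>.\<close>
        obtain y where "x < y" "y \<in> Y" "y \<in> E n k"
          using k unfolding infinite_nat_iff_unbounded by blast
        then show ?thesis using le[of x y] x f_le[of y n k] by force
      qed
      with le show ?thesis by (rule ev_const_mono_bounded)
    qed
  qed
  have "\<exists>k. Y - E n k \<in> I" for n
  proof -
    obtain N v where v: "\<And>x. x \<in> Y \<Longrightarrow> N \<le> x \<Longrightarrow> f x n = v"
      using ev[of n] unfolding ev_const_def by blast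
    obtain k where "infinite (Y \<inter> E n k)" using hit by blast
    then obtain y where "N < y" "y \<in> Y" "y \<in> E n k"
      unfolding infinite_nat_iff_unbounded by blast
    \<comment> \<open>The limit is not the marker \<open>0\<close>, since a point of
      \<open>Y\<close> beyond \<open>N\<close> lies in some \<open>E n k\<close>.\<close>
    then have "0 < v" using v[of y] f_le[of y n k] by simp
    then obtain j where "v = Suc j" using gr0_implies_Suc by blast
    have "x < N" if "x \<in> Y - E n j" for x
      using v[of x] f_Suc[of x n j] \<open>v = Suc j\<close> that not_le by blast
    then have "finite (Y - E n j)" by (intro finite_subset[OF _ finite_lessThan[of N]]) auto
    then show ?thesis using ideal_finite[OF I] by blast
  qed
  with Y show ?thesis by blast
qed

section \<open>Deciding a whole name below one condition\<close>

lemma forces_one_mono: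
  assumes "ideal_on_omega I" "forces_one I r n P" "extends I Q P"
  shows "forces_one I r n Q"
  using assms extends_trans unfolding forces_one_def by blast

lemma forces_value_mono:
  assumes "ideal_on_omega I" "forces_value I r n b P" "extends I Q P"
  shows "forces_value I r n b Q"
proof (cases b)
  case True
  then show ?thesis using assms forces_one_mono unfolding forces_value_def by auto
next
  case False
  then show ?thesis
    using assms(2) extends_trans[OF assms(1) _ assms(3)]
    unfolding forces_value_def forces_not_def by auto
qed

lemma ramsey_not_countable_width:
  assumes I: "ideal_on_omega I" and R: "ramsey_property I" and r: "new_real_name I r"
    and X: "X \<notin> I"
  shows "\<not> countable_width_below I r X"
proof
  assume "countable_width_below I r X"
  then obtain \<A> where "(\<forall>n. maximal_antichain I (\<A> n)) \<and> (\<forall>n. refines I (\<A> (Suc n)) (\<A> n)) \<and>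
      (\<forall>n. \<forall>A\<in>\<A> n. decides_restriction I r n A) \<and> (\<forall>n. countable {A \<in> \<A> n. A \<inter> X \<notin> I})"
    unfolding countable_width_below_def positive_sets_iff ..
  then have max: "\<And>n. maximal_antichain I (\<A> n)"
    and dec: "\<And>n A. A \<in> \<A> n \<Longrightarrow> decides_restriction I r n A"
    and ctb: "\<And>n. countable {A \<in> \<A> n. A \<inter> X \<notin> I}"
    by auto
  define E where "E n = from_nat_into {A \<in> \<A> n. A \<inter> X \<notin> I}" for n
  have predense: "\<exists>A. A \<in> \<A> n \<and> A \<inter> X \<notin> I \<and> Y \<inter> A \<notin> I" if "Y \<subseteq> X" "Y \<notin> I" for Y n
  proof -
    obtain A where A: "A \<in> \<A> n" "Y \<inter> A \<notin> I"
      using maximal_antichain_meets[OF max \<open>Y \<notin> I\<close>] by blast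
    moreover have "A \<inter> X \<notin> I"
      using A(2) ideal_subset[OF I, of "A \<inter> X" "Y \<inter> A"] \<open>Y \<subseteq> X\<close> by blast
    ultimately show ?thesis by blast
  qed
  have E: "E n k \<in> \<A> n" for n k
    using from_nat_into[of "{A \<in> \<A> n. A \<inter> X \<notin> I}" k] predense[OF subset_refl X, of n]
    unfolding E_def by blast
  have "\<exists>k. Y \<inter> E n k \<notin> I" if "Y \<subseteq> X" "Y \<notin> I" for n Y
    using predense[OF that, of n] from_nat_into_surj[OF ctb[of n]] unfolding E_def
    by (metis (no_types, lifting) mem_Collect_eq)
  from ramsey_countable_antichains[OF I R X this]
  obtain Y where "Y \<subseteq> X \<and> Y \<notin> I \<and> (\<forall>n. \<exists>k. Y - E n k \<in> I)" ..
  then have Y: "Y \<notin> I" "\<And>n. \<exists>k. Y - E n k \<in> I" by auto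
  have "\<exists>b. forces_value I r k b Y" for k
  proof -
    \<comment> \<open>Level \<open>n\<close> decides only the coordinates below \<open>n\<close>, so
      coordinate \<open>k\<close> is read off at level \<open>Suc k\<close>.\<close>
    obtain j where "extends I Y (E (Suc k) j)" using Y(2) unfolding extends_def by blast
    moreover obtain s where "\<forall>i<Suc k. forces_value I r i (s i) (E (Suc k) j)"
      using dec[OF E] unfolding decides_restriction_def by blast
    ultimately show ?thesis using forces_value_mono[OF I] by blast
  qed
  then obtain x where "forces_eq I r x Y" unfolding forces_eq_def by metis
  moreover have "extends I Y Y" using subset_extends[OF I] by blast
  ultimately show False
    using r Y(1) unfolding new_real_name_def forces_not_ground_def forces_not_def by auto
qed

section \<open>Distributivity of quotients adding no real\<close>

text \<open>Zorn's lemma gives a maximal family of pairwise incompatible positive members of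
  \<open>D\<close>. A positive set incompatible with all of them would contain a further member of
  \<open>D\<close> that could be added.\<close>

lemma maximal_antichain_in_dense:
  assumes dense: "\<And>B. B \<notin> I \<Longrightarrow> \<exists>C\<subseteq>B. C \<notin> I \<and> C \<in> D" and I: "ideal_on_omega I"
  obtains \<A> where "maximal_antichain I \<A>" "\<A> \<subseteq> D"
proof -
  define F where "F = {\<A>. \<A> \<subseteq> D - I \<and> (\<forall>A\<in>\<A>. \<forall>B\<in>\<A>. A \<noteq> B \<longrightarrow> A \<inter> B \<in> I)}"
  have "\<exists>M\<in>F. \<forall>X\<in>F. M \<subseteq> X \<longrightarrow> X = M"
  proof (rule subset_Zorn_nonempty)
    show "F \<noteq> {}" unfolding F_def by blast
    fix \<C> assume "\<C> \<noteq> {}" and c: "subset.chain F \<C>"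
    have "A \<inter> B \<in> I" if "A \<in> \<Union>\<C>" "B \<in> \<Union>\<C>" "A \<noteq> B" for A B
    proof -
      obtain S T where ST: "S \<in> \<C>" "T \<in> \<C>" "A \<in> S" "B \<in> T" using \<open>A \<in> \<Union>\<C>\<close> \<open>B \<in> \<Union>\<C>\<close> by blast
      then have "S \<subseteq> T \<or> T \<subseteq> S" "S \<in> F" "T \<in> F"
        using c unfolding subset.chain_def by auto
      moreover have "A \<inter> B \<in> I" if "U \<in> F" "A \<in> U" "B \<in> U" for U
        using that \<open>A \<noteq> B\<close> unfolding F_def by simp
      ultimately show ?thesis using ST(3,4) by blast
    qed
    moreover have "\<Union>\<C> \<subseteq> D - I"
      using c unfolding subset.chain_def F_def by blast
    ultimately show "\<Union>\<C> \<in> F" unfolding F_def by blast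
  qed
  then obtain M where M: "M \<in> F" "\<And>X. X \<in> F \<Longrightarrow> M \<subseteq> X \<Longrightarrow> X = M" by blast
  have "\<exists>A\<in>M. P \<inter> A \<notin> I" if "P \<notin> I" for P
  proof (rule ccontr)
    assume neg: "\<not> (\<exists>A\<in>M. P \<inter> A \<notin> I)"
    obtain C where C: "C \<subseteq> P" "C \<notin> I" "C \<in> D" using dense \<open>P \<notin> I\<close> by blast
    have small: "C \<inter> A \<in> I" if "A \<in> M" for A
      using neg that C(1) ideal_subset[OF I, of "P \<inter> A" "C \<inter> A"] by blast
    then have "insert C M \<in> F"
      using M(1) C unfolding F_def by (auto simp: Int_commute)
    then have "C \<in> M" using M(2) by blast
    then show False using small[of C] C(2) by simp
  qed
  with M(1) have "maximal_antichain I M" "M \<subseteq> D"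
    unfolding maximal_antichain_def incompatible_def F_def by auto
  with that show thesis by blast
qed

text \<open>Choose a maximal antichain inside each \<open>D n\<close>. Its members are subsets of
  omega, so the generic choice of one from each is coded by a single real. If \<open>Q\<close>
  forces that real to equal a ground-model \<open>x\<close>, the choice can be decoded from
  \<open>x\<close>, so \<open>Q\<close> lies modulo \<open>I\<close> below one member of each
  antichain.\<close>

lemma no_real_distributive:
  fixes D :: "nat \<Rightarrow> nat set set"
  assumes I: "ideal_on_omega I" and nr: "\<not> adds_real I"
    and dense: "\<And>n B. B \<notin> I \<Longrightarrow> \<exists>C\<subseteq>B. C \<notin> I \<and> C \<in> D n"
  shows "\<exists>Q. Q \<notin> I \<and> (\<forall>n. \<exists>S\<in>D n. Q - S \<in> I)"
proof -
  have "\<exists>\<A>. maximal_antichain I \<A> \<and> \<A> \<subseteq> D n" for n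
    using maximal_antichain_in_dense[OF dense I] by metis
  then obtain \<A> where max: "\<And>n. maximal_antichain I (\<A> n)" and sub: "\<And>n. \<A> n \<subseteq> D n"
    by metis
  have pos: "S \<notin> I" if "S \<in> \<A> n" for n S
    using max[of n] that unfolding maximal_antichain_def by auto
  have anti: "S \<inter> T \<in> I" if "S \<in> \<A> n" "T \<in> \<A> n" "S \<noteq> T" for n S T
    using max[of n] that unfolding maximal_antichain_def incompatible_def by blast
  have ex: "\<exists>S\<in>\<A> n. P \<inter> S \<notin> I" if "P \<notin> I" for n P
    using maximal_antichain_meets[OF max that] .
  \<comment> \<open>A name for the real coding the sequence of those members of the antichains that belong to
    the generic filter.\<close>
  define r where "r = {(prod_encode (n, k), S) | n k S. S \<in> \<A> n \<and> k \<in> S}"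
  have r_iff: "(prod_encode (n, k), S) \<in> r \<longleftrightarrow> S \<in> \<A> n \<and> k \<in> S" for n k S
    unfolding r_def by auto
  have "is_real_name I r" unfolding is_real_name_def r_def using pos by auto
  with nr obtain Q x where Q: "Q \<notin> I" and eq: "forces_eq I r x Q"
    unfolding adds_real_def new_real_name_def forces_not_ground_def forces_not_def by auto
  have S_eq: "S = {k. x (prod_encode (n, k))}" if S: "S \<in> \<A> n" "Q \<inter> S \<notin> I" for S n
  proof -
    have R: "extends I (Q \<inter> S) Q" "extends I (Q \<inter> S) S" using subset_extends[OF I] by blast+
    have "k \<in> S \<longleftrightarrow> x (prod_encode (n, k))" for k
    proof -
      have val: "forces_value I r (prod_encode (n, k)) (x (prod_encode (n, k))) (Q \<inter> S)"
        using eq forces_value_mono[OF I _ R(1)] unfolding forces_eq_def by blast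
      show ?thesis
      proof
        assume k: "k \<in> S"
        have "forces_one I r (prod_encode (n, k)) (Q \<inter> S)"
          unfolding forces_one_def
          by (meson I R(2) S(1) extends_trans k order_refl r_iff subset_extends)
        moreover have "extends I (Q \<inter> S) (Q \<inter> S)" using subset_extends[OF I] by blast
        ultimately show "x (prod_encode (n, k))"
          using val S(2) unfolding forces_value_def forces_not_def by (auto split: if_splits)
      next
        assume x: "x (prod_encode (n, k))"
        have "extends I (Q \<inter> S) (Q \<inter> S)" using subset_extends[OF I] by blast
        then obtain R' S' where R': "R' \<notin> I" "extends I R' (Q \<inter> S)" "S' \<in> \<A> n" "k \<in> S'"
          "extends I R' S'"
          using val x S(2) unfolding forces_value_def forces_one_def r_iff by auto
        \<comment> \<open>Two different members are incompatible, yet the positive set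
          \<open>R'\<close> lies modulo \<open>I\<close> below both.\<close>
        have "S' = S"
        proof (rule ccontr)
          assume "S' \<noteq> S"
          then have "S \<inter> S' \<in> I" using anti S(1) R'(3) by blast
          moreover have "R' - S \<in> I" "R' - S' \<in> I"
            using extends_trans[OF I R'(2) R(2)] R'(5) unfolding extends_def by auto
          ultimately have "(S \<inter> S') \<union> ((R' - S) \<union> (R' - S')) \<in> I" using ideal_Un[OF I] by blast
          then show False using R'(1) ideal_subset[OF I] by blast
        qed
        then show "k \<in> S" using R'(4) by simp
      qed
    qed
    then show ?thesis by blast
  qed
  have "\<exists>S\<in>D n. Q - S \<in> I" for n
  proof -
    obtain S where S: "S \<in> \<A> n" "Q \<inter> S \<notin> I" using ex[OF Q] by blast
    \<comment> \<open>A member \<open>T\<close> meeting \<open>Q - S\<close> positively would be the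
      same slice of \<open>x\<close> as \<open>S\<close>, which is disjoint from
      \<open>Q - S\<close>.\<close>
    have "Q - S \<in> I"
    proof (rule ccontr)
      assume "Q - S \<notin> I"
      then obtain T where T: "T \<in> \<A> n" "(Q - S) \<inter> T \<notin> I" using ex by blast
      then have "Q \<inter> T \<notin> I" using ideal_subset[OF I, of "Q \<inter> T" "(Q - S) \<inter> T"] by blast
      then have "T = S" using S_eq S T(1) by blast
      then have "(Q - S) \<inter> T = {}" by blast
      then show False using T(2) ideal_finite[OF I, of "{}"] by simp
    qed
    then show ?thesis using S(1) sub by blast
  qed
  with Q show ?thesis by blast
qed

section \<open>Restriction of an ideal to a positive set\<close>

definition restrict_ideal :: "nat set set \<Rightarrow> nat set \<Rightarrow> nat set set" where
  "restrict_ideal I A = {B. B \<inter> A \<in> I}"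

lemma ideal_restrict:
  assumes I: "ideal_on_omega I" and A: "A \<notin> I"
  shows "ideal_on_omega (restrict_ideal I A)"
  unfolding ideal_on_omega_def restrict_ideal_def
proof (intro conjI allI impI)
  show "UNIV \<notin> {B. B \<inter> A \<in> I}" using A by simp
  fix B C assume "C \<in> {B. B \<inter> A \<in> I}" "B \<subseteq> C"
  then show "B \<in> {B. B \<inter> A \<in> I}" using ideal_subset[OF I, of "C \<inter> A" "B \<inter> A"] by blast
qed (auto simp: Int_Un_distrib2 intro: ideal_Un[OF I] ideal_finite[OF I])

lemma tall_restrict:
  assumes I: "ideal_on_omega I" and "tall I"
  shows "tall (restrict_ideal I A)"
  using assms(2) ideal_subset[OF I, OF _ Int_lower1]
  unfolding tall_def restrict_ideal_def by blast

lemma ramsey_restrict: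
  assumes "ramsey_property I"
  shows "ramsey_property (restrict_ideal I A)"
  unfolding ramsey_property_def
proof (intro ballI allI)
  fix X and c :: "nat set \<Rightarrow> bool"
  assume "X \<in> positive_sets (restrict_ideal I A)"
  then have "X \<inter> A \<in> positive_sets I" by (simp add: restrict_ideal_def)
  then obtain Y where Y: "Y \<subseteq> X \<inter> A" "Y \<in> positive_sets I" "c constant_on nsets Y 2"
    using assms unfolding ramsey_property_def by blast
  then have "Y \<inter> A = Y" by blast
  with Y show "\<exists>Y\<subseteq>X. Y \<in> positive_sets (restrict_ideal I A) \<and> c constant_on nsets Y 2"
    by (intro exI[of _ Y]) (auto simp: restrict_ideal_def)
qed

lemma char_image_eq: "(\<lambda>A (n::nat). n \<in> A) ` I = {f. {n. f n} \<in> I}"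
proof (intro set_eqI iffI)
  fix f assume "f \<in> {f. {n. f n} \<in> I}"
  then show "f \<in> (\<lambda>A (n::nat). n \<in> A) ` I" by (intro image_eqI[of _ _ "{n. f n}"]) auto
qed auto

text \<open>On characteristic functions the restriction is the preimage of \<open>I\<close> under
  the continuous map that intersects with \<open>A\<close>.\<close>

lemma borel_restrict:
  assumes I: "borel_ideal I" and A: "A \<notin> I"
  shows "borel_ideal (restrict_ideal I A)"
proof -
  define g where "g = (\<lambda>(f :: nat \<Rightarrow> bool) n. f n \<and> n \<in> A)"
  have "continuous_on UNIV (\<lambda>f. g f n)" for n
    by (cases "n \<in> A") (simp_all add: g_def)
  then have "continuous_on UNIV g" by (intro continuous_on_coordinatewise_then_product) auto
  then have "g \<in> borel_measurable borel" by (rule borel_measurable_continuous_onI)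
  moreover have "{f. {n. f n} \<in> I} \<in> sets borel"
    using I unfolding borel_ideal_def char_image_eq by blast
  ultimately have "g -` {f. {n. f n} \<in> I} \<inter> space borel \<in> sets borel"
    by (rule measurable_sets)
  moreover have "g -` {f. {n. f n} \<in> I} \<inter> space borel = {f. {n. f n} \<in> restrict_ideal I A}"
    by (auto simp: g_def restrict_ideal_def Collect_conj_eq)
  ultimately show ?thesis
    using I ideal_restrict[OF _ A] unfolding borel_ideal_def char_image_eq by simp
qed

section \<open>Ramsey sets for semiselective coideals\<close>

definition above :: "nat set \<Rightarrow> nat set" where
  "above b = {n. \<forall>k\<in>b. k < n}"

lemma above_empty [simp]: "above {} = UNIV"
  by (simp add: above_def)

lemma above_insert: "m \<in> above b \<Longrightarrow> above (insert m b) = {m<..}"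
  unfolding above_def by force

lemma above_Max: "finite b \<Longrightarrow> b \<noteq> {} \<Longrightarrow> above b = {Max b<..}"
  unfolding above_def by (simp add: greaterThan_def)

text \<open>Inclusion takes the place of \<open>extends\<close> here. Density is asked below
  \<open>A\<close> only, openness everywhere, so passing to a subset of \<open>A\<close> is
  harmless.\<close>

definition dense_open_below :: "nat set set \<Rightarrow> nat set \<Rightarrow> (nat set \<Rightarrow> bool) \<Rightarrow> bool" where
  "dense_open_below I A D \<longleftrightarrow>
     (\<forall>B\<subseteq>A. B \<notin> I \<longrightarrow> (\<exists>C\<subseteq>B. C \<notin> I \<and> D C)) \<and> (\<forall>B C. D B \<longrightarrow> C \<subseteq> B \<longrightarrow> C \<notin> I \<longrightarrow> D C)"

lemma dense_open_below_dense:
  "dense_open_below I A D \<Longrightarrow> B \<subseteq> A \<Longrightarrow> B \<notin> I \<Longrightarrow> \<exists>C\<subseteq>B. C \<notin> I \<and> D C"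
  unfolding dense_open_below_def by simp

lemma dense_open_below_open:
  "dense_open_below I A D \<Longrightarrow> D B \<Longrightarrow> C \<subseteq> B \<Longrightarrow> C \<notin> I \<Longrightarrow> D C"
  unfolding dense_open_below_def by simp

lemma dense_open_below_subset:
  "dense_open_below I A D \<Longrightarrow> B \<subseteq> A \<Longrightarrow> dense_open_below I B D"
  unfolding dense_open_below_def by blast

lemma dense_open_below_Ball:
  assumes "finite J" "\<And>j. j \<in> J \<Longrightarrow> dense_open_below I A (D j)"
  shows "dense_open_below I A (\<lambda>C. \<forall>j\<in>J. D j C)"
  using assms
proof (induction J rule: finite_induct)
  case empty
  then show ?case unfolding dense_open_below_def by blast
next
  case (insert j J)
  have j: "dense_open_below I A (D j)" and J: "dense_open_below I A (\<lambda>C. \<forall>j\<in>J. D j C)"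
    using insert by auto
  have dense: "\<exists>C\<subseteq>B. C \<notin> I \<and> D j C \<and> (\<forall>j\<in>J. D j C)" if B: "B \<subseteq> A" "B \<notin> I" for B
  proof -
    obtain B' where B': "B' \<subseteq> B" "B' \<notin> I" "D j B'"
      using dense_open_below_dense[OF j B] by blast
    moreover obtain C where C: "C \<subseteq> B'" "C \<notin> I" "\<forall>j\<in>J. D j C"
      using dense_open_below_dense[OF J _ B'(2)] B'(1) B(1) by (meson order_trans)
    moreover have "D j C" by (rule dense_open_below_open[OF j B'(3) C(1,2)])
    ultimately show ?thesis by (meson order_trans)
  qed
  have opn: "\<forall>i\<in>insert j J. D i C" if "\<forall>i\<in>insert j J. D i B" "C \<subseteq> B" "C \<notin> I" for B C
    using dense_open_below_open[OF insert.prems _ that(2,3)] that(1) by simp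
  show ?case
    unfolding dense_open_below_def
  proof (intro conjI allI impI)
    fix B assume "B \<subseteq> A" "B \<notin> I"
    from dense[OF this] show "\<exists>C\<subseteq>B. C \<notin> I \<and> (\<forall>j\<in>insert j J. D j C)" by simp
  qed (rule opn)
qed

text \<open>Farah's semiselectivity for the coideal of positive sets, which supplies the
  diagonalizations in the Galvin-Prikry argument.\<close>

locale semiselective =
  fixes I :: "nat set set"
  assumes ideal: "ideal_on_omega I"
    and diagonal: "\<And>A D. A \<notin> I \<Longrightarrow> (\<And>n. dense_open_below I A (D n)) \<Longrightarrow>
      \<exists>B\<subseteq>A. B \<notin> I \<and> (\<forall>n\<in>B. D n (B \<inter> {n<..}))"
begin

text \<open>Only finitely many \<open>b\<close> lie in \<open>{..n}\<close>, so their dense open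
  sets intersect to a single one indexed by \<open>n\<close>; a nonempty \<open>b\<close> is then
  handled at the point \<open>Max b\<close>.\<close>

lemma diagonal_finite_sets:
  assumes A: "A \<notin> I" and D: "\<And>b. finite b \<Longrightarrow> dense_open_below I A (D b)"
  shows "\<exists>B\<subseteq>A. B \<notin> I \<and> (\<forall>b. finite b \<longrightarrow> b \<subseteq> B \<longrightarrow> D b (B \<inter> above b))"
proof -
  \<comment> \<open>The empty set has no maximum, so it is dealt with beforehand by shrinking
    \<open>A\<close>.\<close>
  obtain A' where A': "A' \<subseteq> A" "A' \<notin> I" "D {} A'"
    using dense_open_below_dense[OF D subset_refl A, of "{}"] by blast
  have "dense_open_below I A' (\<lambda>C. \<forall>b\<in>Pow {..n}. D b C)" for n
    by (intro dense_open_below_Ball)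
      (auto intro: dense_open_below_subset[OF D A'(1)] finite_subset[of _ "{..n}"])
  from diagonal[OF A'(2) this] obtain B where
    "B \<subseteq> A' \<and> B \<notin> I \<and> (\<forall>n\<in>B. \<forall>b\<in>Pow {..n}. D b (B \<inter> {n<..}))" ..
  then have B: "B \<subseteq> A'" "B \<notin> I"
    and B_diag: "\<And>n b. n \<in> B \<Longrightarrow> b \<subseteq> {..n} \<Longrightarrow> D b (B \<inter> {n<..})"
    by auto
  have "D b (B \<inter> above b)" if "finite b" "b \<subseteq> B" for b
  proof (cases "b = {}")
    case True
    then show ?thesis using dense_open_below_open[OF D A'(3) B] by simp
  next
    case False
    then have "Max b \<in> B" using that Max_in by blast
    moreover have "b \<subseteq> {..Max b}" using that(1) by auto
    ultimately show ?thesis using B_diag above_Max[OF that(1) False] by simp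
  qed
  then show ?thesis using A'(1) B by (intro exI[of _ B]) auto
qed

text \<open>Galvin's lemma, localised to the coideal, by accepting and rejecting finite sets. One
  diagonalization makes \<open>B\<close> decide every finite \<open>b\<close>; a second makes
  rejection pass to one-point end-extensions. If the empty set is rejected, so is every finite
  subset of \<open>C\<close>, whereas members of \<open>F\<close> are accepted.\<close>

lemma galvin:
  assumes A: "A \<notin> I"
  obtains B where "B \<subseteq> A" "B \<notin> I" "\<And>Y. Y \<subseteq> B \<Longrightarrow> infinite Y \<Longrightarrow> \<exists>m. Y \<inter> {..<m} \<in> F"
  | B where "B \<subseteq> A" "B \<notin> I" "\<And>Y m. Y \<subseteq> B \<Longrightarrow> infinite Y \<Longrightarrow> Y \<inter> {..<m} \<notin> F"
proof -
  define acc where "acc b C \<longleftrightarrow>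
    (\<forall>Y\<subseteq>C. infinite Y \<longrightarrow> Y \<subseteq> above b \<longrightarrow> (\<exists>m. (b \<union> Y) \<inter> {..<m} \<in> F))" for b C
  define rej where "rej b C \<longleftrightarrow> (\<forall>B\<subseteq>C. B \<notin> I \<longrightarrow> \<not> acc b B)" for b C
  have "dense_open_below I A (\<lambda>C. acc b C \<or> rej b C)" for b
    unfolding dense_open_below_def acc_def rej_def by (meson order_trans order_refl)
  from diagonal_finite_sets[OF A this] obtain B where "B \<subseteq> A \<and> B \<notin> I \<and>
      (\<forall>b. finite b \<longrightarrow> b \<subseteq> B \<longrightarrow> acc b (B \<inter> above b) \<or> rej b (B \<inter> above b))" ..
  then have B: "B \<subseteq> A" "B \<notin> I"
    and dec: "\<And>b. finite b \<Longrightarrow> b \<subseteq> B \<Longrightarrow> acc b (B \<inter> above b) \<or> rej b (B \<inter> above b)"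
    by auto
  show thesis
  proof (cases "acc {} B")
    case True
    show ?thesis by (rule that(1)[OF B]) (use True in \<open>auto simp: acc_def\<close>)
  next
    case False
    then have rej_empty: "rej {} B" using dec[of "{}"] by auto
    \<comment> \<open>Where \<open>b\<close> is not rejected this is vacuous; otherwise every
      available next point must preserve the rejection.\<close>
    define D where "D b C \<longleftrightarrow> (b \<subseteq> B \<longrightarrow> rej b (B \<inter> above b) \<longrightarrow>
      (\<forall>m\<in>B \<inter> C \<inter> above b. rej (insert m b) (B \<inter> above (insert m b))))" for b C
    have "dense_open_below I B (D b)" if b: "finite b" for b
    proof (cases "b \<subseteq> B \<and> rej b (B \<inter> above b)")
      case True
      \<comment> \<open>These next points lose the rejection, so \<open>B\<close> accepts
        \<open>insert m b\<close>. Splitting an infinite subset of \<open>Z\<close> at its minimum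
        shows that \<open>Z\<close> accepts \<open>b\<close>; as \<open>b\<close> is rejected,
        \<open>Z\<close> is in the ideal and can be discarded.\<close>
      define Z where "Z = {m \<in> B \<inter> above b. \<not> rej (insert m b) (B \<inter> above (insert m b))}"
      have "acc b Z" unfolding acc_def
      proof (intro allI impI)
        fix Y assume Y: "Y \<subseteq> Z" "infinite Y"
        define m where "m = (LEAST m. m \<in> Y)"
        have m: "m \<in> Y" "\<And>y. y \<in> Y \<Longrightarrow> m \<le> y"
          unfolding m_def using Y(2) by (auto intro: LeastI Least_le dest: infinite_imp_nonempty)
        then have mZ: "m \<in> B" "m \<in> above b" "acc (insert m b) (B \<inter> {m<..})"
          using Y(1) dec[of "insert m b"] True b unfolding Z_def by (auto simp: above_insert)
        have "Y - {m} \<subseteq> B \<inter> {m<..}" using Y(1) m(2) unfolding Z_def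
          by (force simp: le_less)
        moreover have "infinite (Y - {m})" using Y(2) by simp
        ultimately obtain j where "(insert m b \<union> (Y - {m})) \<inter> {..<j} \<in> F"
          using mZ unfolding acc_def by (metis above_insert le_infE)
        moreover have "insert m b \<union> (Y - {m}) = b \<union> Y" using m(1) by blast
        ultimately show "\<exists>j. (b \<union> Y) \<inter> {..<j} \<in> F" by auto
      qed
      moreover have "Z \<subseteq> B \<inter> above b" unfolding Z_def by blast
      ultimately have "Z \<in> I" using True unfolding rej_def by blast
      then have "C - Z \<notin> I \<and> D b (C - Z)" if "C \<notin> I" for C
        using positive_Diff[OF ideal that] unfolding D_def Z_def by blast
      then have "\<exists>C'\<subseteq>C. C' \<notin> I \<and> D b C'" if "C \<notin> I" for C
        using that by (intro exI[of _ "C - Z"]) auto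
      moreover have "D b C'" if "D b C" "C' \<subseteq> C" for C C'
        using that unfolding D_def by blast
      ultimately show ?thesis unfolding dense_open_below_def by simp
    next
      case False
      then show ?thesis unfolding dense_open_below_def D_def by blast
    qed
    from diagonal_finite_sets[OF B(2) this] obtain C where
      "C \<subseteq> B \<and> C \<notin> I \<and> (\<forall>b. finite b \<longrightarrow> b \<subseteq> C \<longrightarrow> D b (C \<inter> above b))" ..
    then have C: "C \<subseteq> B" "C \<notin> I"
      and C_diag: "\<And>b. finite b \<Longrightarrow> b \<subseteq> C \<Longrightarrow> D b (C \<inter> above b)"
      by auto
    have rej: "rej b (B \<inter> above b)" if "finite b" "b \<subseteq> C" for b
      using that
    proof (induction b rule: finite_linorder_max_induct)
      case empty
      then show ?case using rej_empty by simp
    next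
      case (insert m b)
      then have "m \<in> B \<inter> (C \<inter> above b) \<inter> above b" using C(1) unfolding above_def by auto
      then show ?case using insert C_diag[of b] C(1) unfolding D_def by (meson insert_subset order_trans)
    qed
    show ?thesis
    proof (rule that(2)[of C])
      show "C \<subseteq> A" using B(1) C(1) by blast
      show "C \<notin> I" by (rule C(2))
      fix Y m assume Y: "Y \<subseteq> C" "infinite Y"
      define b where "b = Y \<inter> {..<m}"
      show "Y \<inter> {..<m} \<notin> F"
      proof
        assume "Y \<inter> {..<m} \<in> F"
        then have bF: "b \<in> F" unfolding b_def .
        \<comment> \<open>\<open>b\<close> is itself an initial segment of every
          \<open>b \<union> Z\<close>, cut off at the minimum of \<open>Z\<close>.\<close>
        have "acc b (B \<inter> above b)" unfolding acc_def
        proof (intro allI impI)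
          fix Z assume Z: "Z \<subseteq> B \<inter> above b" "infinite Z"
          define k where "k = (LEAST k. k \<in> Z)"
          have "k \<in> Z" "\<And>z. z \<in> Z \<Longrightarrow> k \<le> z"
            unfolding k_def using Z(2) by (auto intro: LeastI Least_le dest: infinite_imp_nonempty)
          then have "(b \<union> Z) \<inter> {..<k} = b" using Z(1) unfolding above_def by force
          then show "\<exists>m. (b \<union> Z) \<inter> {..<m} \<in> F" using bF by metis
        qed
        moreover have "finite b" "b \<subseteq> C" unfolding b_def using Y(1) by auto
        moreover have "B \<inter> above b \<notin> I"
        proof (cases "b = {}")
          case True
          then show ?thesis using B by simp
        next
          case False
          then show ?thesis
            using positive_Int_greaterThan[OF ideal B(2)] above_Max[OF \<open>finite b\<close>] by simp
        qed
        ultimately show False using rej unfolding rej_def by blast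
      qed
    qed
  qed
qed

section \<open>Ramsey sets form a sigma-algebra\<close>

definition homogeneous :: "nat set \<Rightarrow> nat set set \<Rightarrow> nat set \<Rightarrow> bool" where
  "homogeneous a \<X> B \<longleftrightarrow> (\<exists>v. \<forall>Y\<subseteq>B. infinite Y \<longrightarrow> (a \<union> Y \<in> \<X>) = v)"

text \<open>A local form of complete Ramseyness. Ranging over all finite stems \<open>a\<close> lets
  the diagonalization for countable unions use the stems \<open>a \<union> b\<close>.\<close>

definition ramsey_set :: "nat set set \<Rightarrow> bool" where
  "ramsey_set \<X> \<longleftrightarrow> (\<forall>a A. finite a \<longrightarrow> A \<notin> I \<longrightarrow> (\<exists>B\<subseteq>A. B \<notin> I \<and> homogeneous a \<X> B))"

lemma homogeneous_subset: "homogeneous a \<X> B \<Longrightarrow> C \<subseteq> B \<Longrightarrow> homogeneous a \<X> C"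
  unfolding homogeneous_def by (meson order_trans)

lemma ramsey_set_dense_open:
  "ramsey_set \<X> \<Longrightarrow> finite a \<Longrightarrow> dense_open_below I A (homogeneous a \<X>)"
  unfolding ramsey_set_def dense_open_below_def using homogeneous_subset by blast

lemma ramsey_set_member: "ramsey_set {X. n \<in> X}"
  unfolding ramsey_set_def
proof (intro allI impI)
  fix a A :: "nat set" assume "A \<notin> I"
  then have "A \<inter> {n<..} \<notin> I" by (rule positive_Int_greaterThan[OF ideal])
  moreover have "homogeneous a {X. n \<in> X} (A \<inter> {n<..})"
    unfolding homogeneous_def by (intro exI[of _ "n \<in> a"]) auto
  ultimately show "\<exists>B\<subseteq>A. B \<notin> I \<and> homogeneous a {X. n \<in> X} B" by blast
qed

lemma ramsey_set_Compl: "ramsey_set \<X> \<Longrightarrow> ramsey_set (- \<X>)"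
proof -
  have "homogeneous a (- \<X>) B" if "homogeneous a \<X> B" for a B
  proof -
    from that obtain v where "\<forall>Y\<subseteq>B. infinite Y \<longrightarrow> (a \<union> Y \<in> \<X>) = v"
      unfolding homogeneous_def ..
    then show ?thesis unfolding homogeneous_def by (intro exI[of _ "\<not> v"]) simp
  qed
  then show "ramsey_set \<X> \<Longrightarrow> ramsey_set (- \<X>)" unfolding ramsey_set_def by meson
qed

lemma ramsey_set_UN:
  fixes \<X> :: "nat \<Rightarrow> nat set set"
  assumes "\<And>i. ramsey_set (\<X> i)"
  shows "ramsey_set (\<Union>i. \<X> i)"
  unfolding ramsey_set_def
proof (intro allI impI)
  fix a A :: "nat set" assume a: "finite a" and A: "A \<notin> I"
  \<comment> \<open>The bound \<open>card b\<close> leaves finitely many requirements for each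
    \<open>b\<close>, yet every \<open>i\<close> is covered once \<open>b\<close> is large
    enough.\<close>
  have "dense_open_below I A (\<lambda>C. \<forall>i\<in>{..card b}. homogeneous (a \<union> b) (\<X> i) C)"
    if "finite b" for b
    by (intro dense_open_below_Ball ramsey_set_dense_open assms) (use a that in auto)
  from diagonal_finite_sets[OF A this] obtain B where "B \<subseteq> A \<and> B \<notin> I \<and>
      (\<forall>b. finite b \<longrightarrow> b \<subseteq> B \<longrightarrow>
        (\<forall>i\<in>{..card b}. homogeneous (a \<union> b) (\<X> i) (B \<inter> above b)))" ..
  then have B: "B \<subseteq> A" "B \<notin> I" and hom: "\<And>b. finite b \<Longrightarrow> b \<subseteq> B \<Longrightarrow>
      \<forall>i\<in>{..card b}. homogeneous (a \<union> b) (\<X> i) (B \<inter> above b)"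
    by auto
  \<comment> \<open>On \<open>B\<close> the union is open: the first \<open>i\<close> elements of \<open>Y\<close> decide membership in \<open>\<X> i\<close>.\<close>
  define F where "F = {b. \<exists>i. \<forall>Y\<subseteq>B \<inter> above b. infinite Y \<longrightarrow> a \<union> b \<union> Y \<in> \<X> i}"
  have split: "Y = (Y \<inter> {..<m}) \<union> (Y - {..<m})" "Y - {..<m} \<subseteq> above (Y \<inter> {..<m})"
    "infinite Y \<Longrightarrow> infinite (Y - {..<m})" for Y :: "nat set" and m
    unfolding above_def by auto
  show "\<exists>B\<subseteq>A. B \<notin> I \<and> homogeneous a (\<Union>i. \<X> i) B"
  proof (rule galvin[OF B(2), of F])
    fix C assume C: "C \<subseteq> B" "C \<notin> I" "\<And>Y. Y \<subseteq> C \<Longrightarrow> infinite Y \<Longrightarrow> \<exists>m. Y \<inter> {..<m} \<in> F"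
    have "a \<union> Y \<in> (\<Union>i. \<X> i)" if Y: "Y \<subseteq> C" "infinite Y" for Y
    proof -
      obtain m where "Y \<inter> {..<m} \<in> F" using C(3)[OF Y] by blast
      then obtain i where i: "\<forall>Z\<subseteq>B \<inter> above (Y \<inter> {..<m}). infinite Z \<longrightarrow>
          a \<union> (Y \<inter> {..<m}) \<union> Z \<in> \<X> i"
        unfolding F_def by blast
      have "Y - {..<m} \<subseteq> B \<inter> above (Y \<inter> {..<m})" using split(2) Y(1) C(1) by blast
      with i have "a \<union> (Y \<inter> {..<m}) \<union> (Y - {..<m}) \<in> \<X> i" using split(3)[OF Y(2)] by blast
      then show ?thesis using split(1)[of Y m] by (metis UN_I UNIV_I Un_assoc)
    qed
    then have "homogeneous a (\<Union>i. \<X> i) C" unfolding homogeneous_def by blast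
    then show ?thesis using B(1) C by blast
  next
    fix C assume C: "C \<subseteq> B" "C \<notin> I" "\<And>Y m. Y \<subseteq> C \<Longrightarrow> infinite Y \<Longrightarrow> Y \<inter> {..<m} \<notin> F"
    have "a \<union> Y \<notin> \<X> i" if Y: "Y \<subseteq> C" "infinite Y" for Y i
    proof
      assume mem: "a \<union> Y \<in> \<X> i"
      \<comment> \<open>Cutting above \<open>i\<close> elements of \<open>Y\<close> makes
        homogeneity apply to \<open>\<X> i\<close>. \<open>Y\<close> itself shows the common value
        to be true, which puts the initial segment into \<open>F\<close>.\<close>
      obtain T where T: "finite T" "card T = i" "T \<subseteq> Y"
        using infinite_arbitrarily_large[OF Y(2)] by blast
      obtain m where "T \<subseteq> {..<m}" using T(1) finite_nat_iff_bounded by blast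
      then have "T \<subseteq> Y \<inter> {..<m}" using T(3) by blast
      then have i: "i \<le> card (Y \<inter> {..<m})" using T(2) by (metis card_mono finite_Int finite_lessThan)
      have sub: "Y - {..<m} \<subseteq> B \<inter> above (Y \<inter> {..<m})" using split(2) Y(1) C(1) by blast
      have "homogeneous (a \<union> (Y \<inter> {..<m})) (\<X> i) (B \<inter> above (Y \<inter> {..<m}))"
        using hom[of "Y \<inter> {..<m}"] i Y(1) C(1) by auto
      then obtain v where v: "\<And>Z. Z \<subseteq> B \<inter> above (Y \<inter> {..<m}) \<Longrightarrow> infinite Z \<Longrightarrow>
          (a \<union> (Y \<inter> {..<m}) \<union> Z \<in> \<X> i) = v"
        unfolding homogeneous_def by blast
      have "a \<union> (Y \<inter> {..<m}) \<union> (Y - {..<m}) \<in> \<X> i"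
        using mem split(1)[of Y m] by (metis Un_assoc)
      then have v using v[OF sub split(3)[OF Y(2)]] by blast
      then have "Y \<inter> {..<m} \<in> F" using v unfolding F_def by blast
      then show False using C(3)[OF Y] by blast
    qed
    then have "homogeneous a (\<Union>i. \<X> i) C" unfolding homogeneous_def by blast
    then show ?thesis using B(1) C by blast
  qed
qed

end

text \<open>Second countability of the factor lets Borel measurability into
  \<open>nat \<Rightarrow> bool\<close> be checked coordinatewise.\<close>

instance bool :: second_countable_topology
proof
  have "open = generate_topology (UNIV :: bool set set)"
    by (auto intro: generate_topology.Basis simp: open_discrete fun_eq_iff)
  then show "\<exists>B::bool set set. countable B \<and> open = generate_topology B"
    by (intro exI[of _ UNIV]) (simp add: countable_finite)
qed

section \<open>Borel sets are Ramsey, and tallness fails\<close>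

context semiselective
begin

text \<open>The coordinate sets \<open>{X. n \<in> X}\<close> generate the Borel sets of Cantor
  space, so induction over the generated sigma-algebra applies.\<close>

lemma ramsey_set_borel:
  assumes "S \<in> sets borel"
  shows "ramsey_set {X. (\<lambda>n. n \<in> X) \<in> S}"
proof -
  define M where "M = sigma UNIV {{X::nat set. n \<in> X} | n. True}"
  have M_sets: "sets M = sigma_sets UNIV {{X::nat set. n \<in> X} | n. True}"
    unfolding M_def by (rule sets_measure_of) simp
  have "(\<lambda>X. n \<in> X) \<in> borel_measurable M" for n
  proof (rule measurableI)
    fix B :: "bool set"
    have "{X. n \<in> X} \<in> sets M" unfolding M_sets by (rule sigma_sets.Basic) blast
    then have "Measurable.pred M (\<lambda>X. n \<in> X)" by (simp add: pred_def M_def space_measure_of_conv)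
    then show "(\<lambda>X. n \<in> X) -` B \<inter> space M \<in> sets M" by (rule measurable_sets) simp
  qed simp
  then have "(\<lambda>X n. n \<in> X) \<in> borel_measurable M"
    by (intro measurable_coordinatewise_then_product) simp
  then have "(\<lambda>X n. n \<in> X) -` S \<inter> space M \<in> sets M" using assms by (rule measurable_sets)
  moreover have "(\<lambda>X n. n \<in> X) -` S \<inter> space M = {X. (\<lambda>n. n \<in> X) \<in> S}"
    by (auto simp: M_def space_measure_of_conv)
  ultimately have "{X. (\<lambda>n. n \<in> X) \<in> S} \<in> sigma_sets UNIV {{X::nat set. n \<in> X} | n. True}"
    using M_sets by simp
  then show ?thesis
  proof (induction rule: sigma_sets.induct)
    case (Basic a)
    then show ?case using ramsey_set_member by blast
  next
    case Empty
    show ?case unfolding ramsey_set_def homogeneous_def by blast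
  next
    case (Compl a)
    then show ?case using ramsey_set_Compl by (simp add: Compl_eq_Diff_UNIV)
  next
    case (Union a)
    then show ?case by (intro ramsey_set_UN)
  qed
qed

lemma not_tall_borel:
  assumes "borel_ideal I"
  shows "\<not> tall I"
proof
  assume "tall I"
  have "{X. (\<lambda>n. n \<in> X) \<in> (\<lambda>A n. n \<in> A) ` I} = I" unfolding char_image_eq by simp
  then have "ramsey_set I"
    using assms ramsey_set_borel unfolding borel_ideal_def by metis
  moreover have "UNIV \<notin> I" using ideal unfolding ideal_on_omega_def by blast
  ultimately obtain B v where B: "B \<notin> I" and v: "\<And>Y. Y \<subseteq> B \<Longrightarrow> infinite Y \<Longrightarrow> (Y \<in> I) = v"
    unfolding ramsey_set_def homogeneous_def by (metis finite.emptyI sup_bot_left)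
  have "infinite B" using B by (rule ideal_positive_infinite[OF ideal])
  moreover obtain Y where "Y \<subseteq> B" "infinite Y" "Y \<in> I"
    using \<open>tall I\<close> \<open>infinite B\<close> unfolding tall_def by blast
  \<comment> \<open>\<open>B\<close> itself makes \<open>v\<close> false, while \<open>Y\<close>
    makes it true.\<close>
  ultimately show False using v B by blast
qed

end

text \<open>Failure of \<open>adds_real\<close> yields just one condition, so it is assumed for
  every restriction in order to work below each \<open>A\<close>. Distributivity gives
  \<open>C\<close> contained modulo \<open>I\<close> in sets \<open>S n\<close> with
  \<open>D n (S n)\<close>; the Ramsey property then turns this into true inclusion beyond each
  point \<open>n\<close>.\<close>

lemma ramsey_no_real_semiselective:
  assumes I: "ideal_on_omega I" and R: "ramsey_property I"
    and nr: "\<And>A. A \<notin> I \<Longrightarrow> \<not> adds_real (restrict_ideal I A)"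
  shows "semiselective I"
proof
  show "ideal_on_omega I" by (rule I)
  fix A and D :: "nat \<Rightarrow> nat set \<Rightarrow> bool"
  assume A: "A \<notin> I" and D: "\<And>n. dense_open_below I A (D n)"
  let ?J = "restrict_ideal I A"
  have "\<exists>C\<subseteq>B. C \<notin> ?J \<and> C \<in> {S. D n S}" if "B \<notin> ?J" for n B
  proof -
    have "B \<inter> A \<notin> I" using that unfolding restrict_ideal_def by simp
    then obtain C where "C \<subseteq> B \<inter> A" "C \<notin> I" "D n C"
      using D[of n] unfolding dense_open_below_def by (meson inf_le2)
    moreover from this have "C \<inter> A = C" by blast
    ultimately show ?thesis unfolding restrict_ideal_def by auto
  qed
  from no_real_distributive[OF ideal_restrict[OF I A] nr[OF A] this]
  obtain Q where "Q \<notin> ?J \<and> (\<forall>n. \<exists>S\<in>{S. D n S}. Q - S \<in> ?J)" ..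
  then have Q: "Q \<notin> ?J" "\<And>n. \<exists>S\<in>{S. D n S}. Q - S \<in> ?J" by auto
  define C where "C = Q \<inter> A"
  have C: "C \<notin> I" using Q(1) unfolding C_def restrict_ideal_def by simp
  have "\<exists>S. D n S \<and> C - S \<in> I" for n
    using Q(2)[of n] unfolding C_def restrict_ideal_def by (auto simp: Int_Diff Diff_Int_distrib2 Int_commute)
  then obtain S where S: "\<And>n. D n (S n)" "\<And>n. C - S n \<in> I" by metis
  show "\<exists>B\<subseteq>A. B \<notin> I \<and> (\<forall>n\<in>B. D n (B \<inter> {n<..}))"
  proof (rule ramsey_property_pairs[OF R C, of "\<lambda>m n. n \<in> S m"])
    fix B assume B: "B \<subseteq> C" "B \<notin> I" "\<And>x y. x \<in> B \<Longrightarrow> y \<in> B \<Longrightarrow> x < y \<Longrightarrow> y \<in> S x"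
    have "D n (B \<inter> {n<..})" if "n \<in> B" for n
    proof -
      have "B \<inter> {n<..} \<subseteq> S n" using B(3) that by auto
      then show ?thesis
        using D[of n] S(1) positive_Int_greaterThan[OF I B(2)] unfolding dense_open_below_def by blast
    qed
    then show ?thesis using B unfolding C_def by blast
  next
    fix B assume B: "B \<subseteq> C" "B \<notin> I" "\<And>x y. x \<in> B \<Longrightarrow> y \<in> B \<Longrightarrow> x < y \<Longrightarrow> y \<notin> S x"
    have "B \<noteq> {}" using B(2) ideal_finite[OF I, of "{}"] by auto
    then obtain m where m: "m \<in> B" by blast
    \<comment> \<open>This colour cannot occur: the part of \<open>B\<close> beyond \<open>m\<close>
      is positive, while \<open>C - S m\<close> is in the ideal.\<close>
    have "B \<inter> {m<..} \<subseteq> C - S m" using B m by auto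
    then show ?thesis
      using S(2) ideal_subset[OF I] positive_Int_greaterThan[OF I B(2)] by blast
  qed
qed

theorem corollary7p4:
  assumes DW: "\<And>I. \<lbrakk>borel_ideal I; tall I; adds_real I\<rbrakk> \<Longrightarrow>
    \<exists>r X. new_real_name I r \<and> X \<in> positive_sets I \<and> countable_width_below I r X"
  shows "\<not> (\<exists>I. borel_ideal I \<and> tall I \<and> ramsey_property I)"
proof
  assume "\<exists>I. borel_ideal I \<and> tall I \<and> ramsey_property I"
  then obtain I where B: "borel_ideal I" and T: "tall I" and R: "ramsey_property I" by blast
  have I: "ideal_on_omega I" using B unfolding borel_ideal_def by blast
  have "\<not> adds_real (restrict_ideal I A)" if A: "A \<notin> I" for A
    using DW[OF borel_restrict[OF B A] tall_restrict[OF I T]]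
      ramsey_not_countable_width[OF ideal_restrict[OF I A] ramsey_restrict[OF R]]
    by auto
  then interpret semiselective I by (rule ramsey_no_real_semiselective[OF I R])
  show False using not_tall_borel[OF B] T by blast
qed

end
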